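(* Let $q\in(0,1)$. If $f(z)=z+\sum_{n=2}^\infty a_nz^n$ belongs to $\mathcal{K}_q$ with the Koebe function $g(z)=z/(1-z)^2$, then for all $n\ge 2$ $$|a_n|\le\frac{1-q}{1-q^n}\left[n+(1+q)\,\frac{n(n-1)}{2}\right].$$
   Context: $\mathbb{D}=\{z\in\mathbb{C}:|z|<1\}$. $\mathcal{A}$ is the class of functions $f$ analytic in $\mathbb{D}$ with $f(0)=0=f'(0)-1$. $\mathcal{S}^*\subset\mathcal{A}$ is the class of univalent functions $g\in\mathcal{A}$ that are starlike with respect to the origin. For $q\in(0,1)$ and $f\in\mathcal{A}$, the $q$-difference operator is $(D_qf)(z)=\dfrac{f(z)-f(qz)}{z(1-q)}$ for $z\in\mathbb{D}\setminus\{0\}$, and $(D_qf)(0)=f'(0)$. A function $f\in\mathcal{A}$ belongs to $\mathcal{K}_q$ if there exists $g\in\mathcal{S}^*$ such that $$\left|\frac{z}{g(z)}(D_qf)(z)-\frac{1}{1-q}\right|\le\frac{1}{1-q},\quad z\in\mathbb{D}$$ (where $z/g(z)$ is given its limit value $1$ at $z=0$); one then says that $f\in\mathcal{K}_q$ with the function $g$. *)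

theory Defs
  imports "HOL-Complex_Analysis.Complex_Analysis"
begin

abbreviation unit_disc :: "complex set" where
  "unit_disc \<equiv> ball 0 1"

definition class_A :: "(complex \<Rightarrow> complex) set" where
  "class_A = {f. f holomorphic_on unit_disc \<and> f 0 = 0 \<and> deriv f 0 = 1}"

text \<open>The library predicate \<open>starlike\<close> leaves the centre existentially quantified;
  here the centre has to be the origin.\<close>

definition starlike_class :: "(complex \<Rightarrow> complex) set" where
  "starlike_class = {g \<in> class_A. inj_on g unit_disc \<and>
     (\<forall>w \<in> g ` unit_disc. closed_segment 0 w \<subseteq> g ` unit_disc)}"

definition q_diff :: "real \<Rightarrow> (complex \<Rightarrow> complex) \<Rightarrow> complex \<Rightarrow> complex" where
  "q_diff q f z =
     (if z = 0 then deriv f 0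
      else (f z - f (of_real q * z)) / (z * (1 - of_real q)))"

text \<open>The function \<open>z / g z\<close> for \<open>g\<close> in \<open>class_A\<close>, with its removable singularity at the
  origin filled by the limit \<open>1 / deriv g 0 = 1\<close>.\<close>

definition z_over :: "(complex \<Rightarrow> complex) \<Rightarrow> complex \<Rightarrow> complex" where
  "z_over g z = (if z = 0 then 1 else z / g z)"

definition Kq_with :: "real \<Rightarrow> (complex \<Rightarrow> complex) \<Rightarrow> (complex \<Rightarrow> complex) \<Rightarrow> bool" where
  "Kq_with q f g \<longleftrightarrow> f \<in> class_A \<and> g \<in> starlike_class \<and>
     (\<forall>z \<in> unit_disc.
        cmod (z_over g z * q_diff q f z - of_real (1 / (1 - q))) \<le> 1 / (1 - q))"

definition Kq :: "real \<Rightarrow> (complex \<Rightarrow> complex) set" where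
  "Kq q = {f. \<exists>g. Kq_with q f g}"

definition koebe :: "complex \<Rightarrow> complex" where
  "koebe z = z / (1 - z)^2"

end

theory Submission
  imports Defs
begin

text \<open>
  For the Koebe function, \<open>z / g z = (1 - z)\<^sup>2\<close>. So the hypothesis says that
  \<open>h z = (1 - z)\<^sup>2 * q_diff q f z\<close> takes its values in the disc with centre and radius
  \<open>1 / (1 - q)\<close>; equivalently, \<open>w = (1 - q) * h - 1\<close> is bounded by \<open>1\<close>, and
  \<open>w 0 = - q\<close> since \<open>h 0 = 1\<close>. By \<open>coeff_bound_of_bounded\<close>, every later Taylor coefficient
  of \<open>w\<close> is at most \<open>1 - q\<^sup>2\<close> in modulus, and therefore every later coefficient of \<open>h\<close> is at
  most \<open>1 + q\<close>. This gain over the trivial bound \<open>1 / (1 - q)\<close> is the heart of the matter.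

  Dividing by \<open>1 - z\<close> replaces the coefficients of a power series by their partial sums
  (\<open>backward_diff_sums\<close> and \<open>sum_backward_diff\<close>). Doing this twice recovers
  \<open>q_diff q f\<close> from \<open>h\<close> and bounds its coefficient of index \<open>n - 1\<close> by the sum of
  \<open>1 + (1 + q) * j\<close> over \<open>j < n\<close>, which is \<open>n + (1 + q) * n * (n - 1) / 2\<close>. By \<open>q_diff_sums\<close>
  this coefficient is \<open>(1 - q ^ n) / (1 - q)\<close> times \<open>a n\<close>.
\<close>

lemma sum_powers_root_of_unity:
  fixes n k :: nat
  assumes "n > 0"
  shows "(\<Sum>j<n. (cis (2 * pi / real n) ^ j) ^ k) = (if n dvd k then of_nat n else 0)"
proof -
  define x where "x = cis (2 * pi / real n) ^ k"
  have x: "x = exp (2 * of_real pi * \<i> * of_nat k / of_nat n)"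
    by (simp add: x_def cis_conv_exp exp_of_nat_mult[symmetric] field_simps)
  have "x ^ n = cis (2 * pi / real n) ^ (n * k)"
    by (simp add: x_def power_mult[symmetric] mult.commute)
  also have "\<dots> = 1"
    using assms cis_multiple_2pi[of "real k"] by (simp add: Complex.DeMoivre mult_ac)
  finally have xn: "x ^ n = 1" .
  have x1: "x = 1 \<longleftrightarrow> n dvd k"
    using complex_root_unity_eq_1[of n k] assms by (simp add: x)
  have "(\<Sum>j<n. (cis (2 * pi / real n) ^ j) ^ k) = (\<Sum>j<n. x ^ j)"
    by (simp add: x_def power_mult[symmetric] mult.commute)
  also have "\<dots> = (if n dvd k then of_nat n else 0)"
    using xn x1 by (simp add: sum_gp_strict)
  finally show ?thesis .
qed

text \<open>
  Subtracting \<open>b 0\<close> from \<open>w\<close> leaves a function \<open>z ^ n * V z\<close> with \<open>V 0 = b n\<close>, because of the gap.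
  A Moebius map of the disc that sends \<open>b 0\<close> to \<open>0\<close> thus turns \<open>w\<close> into
  \<open>z ^ n * G z\<close> with \<open>G 0 = b n / (1 - (norm (b 0))\<^sup>2)\<close>, still bounded by \<open>1\<close>, and the maximum
  modulus principle for \<open>G\<close> gives \<open>norm (G 0) \<le> 1\<close>.

  If \<open>norm (b 0) = 1\<close>, the Moebius map degenerates. The argument is therefore applied to
  \<open>s * w\<close> with \<open>s < 1\<close>. As the circle for the maximum modulus principle must also stay inside the
  disc, its radius is taken to be \<open>s\<close> too, and one limit \<open>s \<rightarrow> 1\<close> removes both shrinkings.
\<close>

lemma coeff_bound_of_bounded_lacunary:
  fixes b :: "nat \<Rightarrow> complex" and w :: "complex \<Rightarrow> complex" and n :: nat
  assumes sums: "\<And>z. norm z < 1 \<Longrightarrow> (\<lambda>k. b k * z ^ k) sums w z"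
    and bound: "\<And>z. norm z < 1 \<Longrightarrow> norm (w z) \<le> 1"
    and "n > 0" and gap: "\<And>k. 0 < k \<Longrightarrow> k < n \<Longrightarrow> b k = 0"
  shows "norm (b n) \<le> 1 - (norm (b 0))\<^sup>2"
proof -
  have w0: "w 0 = b 0"
    using sums_unique2[OF sums[of 0] powser_sums_zero[of b]] by simp
  have b0: "norm (b 0) \<le> 1"
    using bound[of 0] w0 by simp
  define V where "V z = (if z = 0 then b n else (w z - b 0) / z ^ n)" for z
  have V_sums: "(\<lambda>k. b (k + n) * z ^ k) sums V z" if z: "norm z < 1" for z
  proof (cases "z = 0")
    case True
    then show ?thesis using powser_sums_zero[of "\<lambda>k. b (k + n)"] by (simp add: V_def)
  next
    case False
    have "(\<Sum>k<n. b k * z ^ k) = (\<Sum>k\<in>{0}. b k * z ^ k)"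
      using \<open>n > 0\<close> gap by (intro sum.mono_neutral_right) auto
    then have "(\<lambda>k. b (k + n) * z ^ (k + n)) sums (w z - b 0)"
      using sums_split_initial_segment[OF sums[OF z], of n] by simp
    from sums_divide[OF this, of "z ^ n"] show ?thesis
      using False by (simp add: V_def power_add)
  qed
  have w_hol: "w holomorphic_on ball 0 1"
    using sums by (intro power_series_holomorphic[where a = b]) (auto simp: dist_norm)
  have V_hol: "V holomorphic_on ball 0 1"
    using V_sums
    by (intro power_series_holomorphic[where a = "\<lambda>k. b (k + n)"]) (auto simp: dist_norm)
  have V_w: "w z - b 0 = z ^ n * V z" for z
    using w0 \<open>n > 0\<close> by (simp add: V_def)
  have scaled: "s ^ (n + 1) * norm (b n) \<le> 1 - s\<^sup>2 * (norm (b 0))\<^sup>2"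
    if s: "0 < s" "s < 1" for s :: real
  proof -
    define \<beta> where "\<beta> = of_real s * b 0"
    have \<beta>: "norm \<beta> \<le> s"
      using s b0 by (simp add: \<beta>_def norm_mult mult_left_le)
    have sw: "norm (of_real s * w z) \<le> s" if "norm z < 1" for z
      using s bound[OF that] by (simp add: norm_mult mult_left_le)
    have den: "1 - cnj \<beta> * (of_real s * w z) \<noteq> 0" if "norm z < 1" for z
    proof
      assume "1 - cnj \<beta> * (of_real s * w z) = 0"
      then have "norm (cnj \<beta> * (of_real s * w z)) = 1" by simp
      moreover have "norm (cnj \<beta> * (of_real s * w z)) \<le> s * s"
        using \<beta> sw[OF that] s by (auto simp only: norm_mult complex_mod_cnj intro!: mult_mono) auto
      moreover have "s * s < 1" using s mult_strict_mono[of s 1 s 1] by simp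
      ultimately show False by simp
    qed
    define G where "G z = of_real s * V z / (1 - cnj \<beta> * (of_real s * w z))" for z
    have "G holomorphic_on ball 0 1"
      unfolding G_def using den by (intro holomorphic_intros V_hol w_hol) auto
    then have G_hol: "G holomorphic_on cball 0 s"
      using s by (rule_tac holomorphic_on_subset) auto
    have "norm (G 0) \<le> 1 / s ^ n"
    proof (rule maximum_modulus_frontier[of G "cball 0 s"])
      show "G holomorphic_on interior (cball 0 s)"
        using G_hol by (rule holomorphic_on_subset) auto
      show "continuous_on (closure (cball 0 s)) G"
        using G_hol holomorphic_on_imp_continuous_on by simp
      fix z :: complex assume "z \<in> frontier (cball 0 s)"
      then have zs: "norm z = s" using s by (simp add: dist_norm)
      then have z1: "norm z < 1" using s by simp
      have "norm ((of_real s * w z - \<beta>) / (1 - cnj \<beta> * (of_real s * w z))) < 1"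
        using Moebius_function_norm_lt_1[of \<beta> "of_real s * w z" 0] \<beta> sw[OF z1] s
        by (simp add: Moebius_function_def)
      also have "(of_real s * w z - \<beta>) / (1 - cnj \<beta> * (of_real s * w z)) = z ^ n * G z"
        using V_w[of z] by (simp add: G_def \<beta>_def right_diff_distrib[symmetric])
      finally show "norm (G z) \<le> 1 / s ^ n"
        using s zs by (simp add: norm_mult norm_power field_simps)
    qed (use s in auto)
    moreover have "G 0 = of_real s * b n / of_real (1 - s\<^sup>2 * (norm (b 0))\<^sup>2)"
    proof -
      have "cnj \<beta> * (of_real s * b 0) = of_real (s\<^sup>2) * (b 0 * cnj (b 0))"
        by (simp add: \<beta>_def power2_eq_square)
      then have "cnj \<beta> * (of_real s * b 0) = of_real (s\<^sup>2 * (norm (b 0))\<^sup>2)"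
        by (simp only: complex_norm_square of_real_mult)
      then show ?thesis
        by (simp only: G_def V_def w0 of_real_diff of_real_1 if_True simp_thms)
    qed
    moreover have pos: "s\<^sup>2 * (norm (b 0))\<^sup>2 < 1"
      using s b0 by (smt (verit) mult_left_le power_le_one norm_ge_zero zero_le_power2 power_strict_mono one_power2 zero_less_numeral power_less_one_iff)
    ultimately have "s * norm (b n) / (1 - s\<^sup>2 * (norm (b 0))\<^sup>2) \<le> 1 / s ^ n"
      using s by (simp add: norm_divide norm_mult del: of_real_diff of_real_mult)
    then show ?thesis
      using s pos by (simp add: field_simps)
  qed
  show ?thesis
  proof (rule tendsto_le[of "at_left (1::real)"])
    show "((\<lambda>s. s ^ (n + 1) * norm (b n)) \<longlongrightarrow> norm (b n)) (at_left 1)"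
      by (auto intro!: tendsto_eq_intros)
    show "((\<lambda>s. 1 - s\<^sup>2 * (norm (b 0))\<^sup>2) \<longlongrightarrow> 1 - (norm (b 0))\<^sup>2) (at_left 1)"
      by (auto intro!: tendsto_eq_intros)
    show "\<forall>\<^sub>F s in at_left 1. s ^ (n + 1) * norm (b n) \<le> 1 - s\<^sup>2 * (norm (b 0))\<^sup>2"
      using eventually_at_left_real[of 0 "1::real"] scaled
      by (auto elim!: eventually_mono)
  qed simp
qed

text \<open>
  Averaging \<open>w\<close> over the rotations by the \<open>n\<close>-th roots of unity preserves the bound and kills
  exactly the coefficients whose index is not a multiple of \<open>n\<close>. This creates the gap between
  the indices \<open>0\<close> and \<open>n\<close> that the previous argument needs, and leaves both end coefficients unchanged.
\<close>

lemma coeff_bound_of_bounded: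
  fixes b :: "nat \<Rightarrow> complex" and w :: "complex \<Rightarrow> complex" and n :: nat
  assumes sums: "\<And>z. norm z < 1 \<Longrightarrow> (\<lambda>k. b k * z ^ k) sums w z"
    and bound: "\<And>z. norm z < 1 \<Longrightarrow> norm (w z) \<le> 1"
    and n: "n > 0"
  shows "norm (b n) \<le> 1 - (norm (b 0))\<^sup>2"
proof -
  define \<zeta> where "\<zeta> = cis (2 * pi / real n)"
  define b' where "b' k = (if n dvd k then b k else 0)" for k
  define w' where "w' z = (\<Sum>j<n. w (\<zeta> ^ j * z)) / of_nat n" for z
  have \<zeta>_norm: "norm (\<zeta> ^ j * z) = norm z" for j z
    by (simp add: \<zeta>_def norm_mult norm_power)
  have "norm (b' n) \<le> 1 - (norm (b' 0))\<^sup>2"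
  proof (rule coeff_bound_of_bounded_lacunary[OF _ _ n])
    fix z :: complex assume z: "norm z < 1"
    have "(\<lambda>k. (\<Sum>j<n. b k * (\<zeta> ^ j * z) ^ k) / of_nat n) sums w' z"
      unfolding w'_def using z by (intro sums_divide sums_sum sums) (simp add: \<zeta>_norm)
    moreover have "(\<Sum>j<n. b k * (\<zeta> ^ j * z) ^ k) / of_nat n = b' k * z ^ k" for k
    proof -
      have "(\<Sum>j<n. b k * (\<zeta> ^ j * z) ^ k) = b k * z ^ k * (\<Sum>j<n. (\<zeta> ^ j) ^ k)"
        by (simp add: sum_distrib_left power_mult_distrib mult_ac)
      then show ?thesis
        using n by (simp add: \<zeta>_def sum_powers_root_of_unity b'_def)
    qed
    ultimately show "(\<lambda>k. b' k * z ^ k) sums w' z" by simp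
    have "norm (\<Sum>j<n. w (\<zeta> ^ j * z)) \<le> of_nat (card {..<n}) * 1"
      using z by (intro sum_norm_bound bound) (simp add: \<zeta>_norm)
    then show "norm (w' z) \<le> 1"
      using n by (simp add: w'_def norm_divide)
  next
    show "b' k = 0" if "0 < k" "k < n" for k
      using that by (auto simp: b'_def dest: dvd_imp_le)
  qed
  then show ?thesis by (simp add: b'_def)
qed

definition backward_diff :: "(nat \<Rightarrow> complex) \<Rightarrow> nat \<Rightarrow> complex" where
  "backward_diff d k = d k - (if k = 0 then 0 else d (k - 1))"

lemma backward_diff_sums:
  assumes "(\<lambda>k. d k * z ^ k) sums s"
  shows "(\<lambda>k. backward_diff d k * z ^ k) sums ((1 - z) * s)"
proof -
  have "(\<lambda>k. z * (d k * z ^ k)) sums (z * s)"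
    using assms by (rule sums_mult)
  then have "(\<lambda>k. (if k = 0 then 0 else d (k - 1)) * z ^ k) sums (z * s)"
    using sums_Suc_iff[where s = "z * s" and f = "\<lambda>k. (if k = 0 then 0 else d (k - 1)) * z ^ k"]
    by (simp add: mult_ac)
  from sums_diff[OF assms this] show ?thesis
    by (simp add: backward_diff_def algebra_simps)
qed

lemma sum_backward_diff: "(\<Sum>j\<le>k. backward_diff d j) = d k"
  by (induction k) (auto simp: backward_diff_def)

text \<open>
  The operator acts diagonally on monomials: it sends \<open>z ^ n\<close> to
  \<open>(1 - q ^ n) / (1 - q) * z ^ (n - 1)\<close>. The linear term of \<open>f\<close>, which the
  normalization makes \<open>z\<close>, contributes the constant \<open>1\<close>.
\<close>

lemma q_diff_sums:
  fixes q :: real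
  assumes q: "0 < q" "q < 1"
    and a: "\<And>z. z \<in> unit_disc \<Longrightarrow> (\<lambda>n. a (n + 2) * z ^ (n + 2)) sums (f z - z)"
    and f: "deriv f 0 = 1" and z: "norm z < 1"
  shows "(\<lambda>k. (if k = 0 then 1 else a (k + 1) * of_real ((1 - q ^ (k + 1)) / (1 - q))) * z ^ k)
           sums q_diff q f z"  (is "(\<lambda>k. ?d k * z ^ k) sums _")
proof (cases "z = 0")
  case True
  then show ?thesis using powser_sums_zero[of ?d] f by (simp add: q_diff_def)
next
  case False
  have "norm (of_real q * z) < 1"
    using q z by (simp add: norm_mult) (smt (verit) mult_left_le norm_ge_zero mult_less_cancel_right2)
  then have "(\<lambda>n. a (n + 2) * (of_real q * z) ^ (n + 2)) sums (f (of_real q * z) - of_real q * z)"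
    using a[of "of_real q * z"] by simp
  moreover have "(\<lambda>n. a (n + 2) * z ^ (n + 2)) sums (f z - z)"
    using a[of z] z by simp
  ultimately have "(\<lambda>n. (a (n + 2) * z ^ (n + 2) - a (n + 2) * (of_real q * z) ^ (n + 2)) / (z * (1 - of_real q)))
    sums ((f z - z - (f (of_real q * z) - of_real q * z)) / (z * (1 - of_real q)))"
    by (intro sums_divide sums_diff)
  moreover have q1: "(1 - of_real q :: complex) \<noteq> 0"
    using q by (metis eq_iff_diff_eq_0 of_real_eq_1_iff order_less_irrefl)
  moreover have "(a (n + 2) * z ^ (n + 2) - a (n + 2) * (of_real q * z) ^ (n + 2)) / (z * (1 - of_real q))
      = ?d (Suc n) * z ^ Suc n" for n
    using False q1 by (simp add: power_mult_distrib field_simps)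
  moreover have "(f z - z - (f (of_real q * z) - of_real q * z)) / (z * (1 - of_real q)) = q_diff q f z - 1"
    using False q1 by (simp add: q_diff_def field_simps)
  ultimately have "(\<lambda>n. ?d (Suc n) * z ^ Suc n) sums (q_diff q f z - 1)"
    by simp
  then show ?thesis
    by (subst (asm) sums_Suc_iff) simp
qed

theorem corollary3p3:
  fixes q :: real and f :: "complex \<Rightarrow> complex" and a :: "nat \<Rightarrow> complex"
  assumes "0 < q" and "q < 1"
    and "\<And>z. z \<in> unit_disc \<Longrightarrow> (\<lambda>n. a (n + 2) * z ^ (n + 2)) sums (f z - z)"
    and "Kq_with q f koebe"
  shows "\<forall>n\<ge>2. cmod (a n) \<le>
           (1 - q) / (1 - q ^ n) * (real n + (1 + q) * (real n * (real n - 1) / 2))"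
proof -
  have f1: "deriv f 0 = 1"
    and bd: "\<And>z. norm z < 1 \<Longrightarrow>
      cmod (z_over koebe z * q_diff q f z - of_real (1 / (1 - q))) \<le> 1 / (1 - q)"
    using assms(4) by (auto simp: Kq_with_def class_A_def)
  \<comment> \<open>The coefficients of \<open>q_diff q f\<close>; those of \<open>h\<close> below are their second differences.\<close>
  define d where
    "d k = (if k = 0 then 1 else a (k + 1) * of_real ((1 - q ^ (k + 1)) / (1 - q)))" for k
  define h where "h z = (1 - z) * ((1 - z) * q_diff q f z)" for z
  define c where "c = backward_diff (backward_diff d)"
  have h_sums: "(\<lambda>k. c k * z ^ k) sums h z" if "norm z < 1" for z
    unfolding c_def h_def d_def
    by (intro backward_diff_sums q_diff_sums assms(1-3) f1 that)
  have h_bound: "norm (of_real (1 - q) * h z - 1) \<le> 1" if "norm z < 1" for z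
  proof -
    have "z \<noteq> 1" using that by auto
    then have koebe: "z_over koebe z = (1 - z)\<^sup>2"
      by (simp add: z_over_def koebe_def)
    have one: "of_real (1 - q) * of_real (1 / (1 - q)) = (1 :: complex)"
      using assms(2) by (simp flip: of_real_mult del: of_real_diff)
    have "of_real (1 - q) * h z - 1 = of_real (1 - q) *
        (z_over koebe z * q_diff q f z - of_real (1 / (1 - q)))"
      unfolding koebe right_diff_distrib[of "of_real (1 - q)"] one
      by (simp only: h_def power2_eq_square mult.assoc)
    also have "norm \<dots> = (1 - q) * norm (z_over koebe z * q_diff q f z - of_real (1 / (1 - q)))"
      using assms(2) by (simp only: norm_mult norm_of_real)
    also have "\<dots> \<le> (1 - q) * (1 / (1 - q))"
      using assms(2) bd[OF that] by (intro mult_left_mono) auto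
    finally show ?thesis using assms(2) by simp
  qed
  have c0: "c 0 = 1"
    by (simp add: c_def backward_diff_def d_def)
  have c_bound: "norm (c k) \<le> 1 + q" if "k > 0" for k
  proof -
    \<comment> \<open>Subtracting \<open>1\<close> from \<open>(1 - q) * h\<close> only moves the constant term, from \<open>1 - q\<close> to \<open>- q\<close>.\<close>
    define b where "b j = of_real (1 - q) * c j - (if j = 0 then 1 else 0)" for j
    have "(\<lambda>j. b j * z ^ j) sums (of_real (1 - q) * h z - 1)" if "norm z < 1" for z
    proof -
      have "(\<lambda>j. of_real (1 - q) * (c j * z ^ j) - (if j = 0 then 1 else 0)) sums (of_real (1 - q) * h z - 1)"
        by (intro sums_diff sums_mult h_sums that) (use sums_single[of 0 "\<lambda>_. 1"] in simp)
      moreover have "b j * z ^ j = of_real (1 - q) * (c j * z ^ j) - (if j = 0 then 1 else 0)" for j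
        by (simp add: b_def)
      ultimately show ?thesis by simp
    qed
    from coeff_bound_of_bounded[OF this h_bound that]
    have "norm (b k) \<le> 1 - (norm (b 0))\<^sup>2" .
    moreover have "norm (b 0) = q"
      using assms(1) by (simp add: b_def c0)
    moreover have "norm (b k) = (1 - q) * norm (c k)"
      using that assms(2) by (simp add: b_def norm_mult del: of_real_diff)
    ultimately have "(1 - q) * norm (c k) \<le> (1 - q) * (1 + q)"
      by (simp add: power2_eq_square algebra_simps)
    then show ?thesis using assms(2) by simp
  qed
  have e_bound: "norm (backward_diff d k) \<le> 1 + (1 + q) * real k" for k
  proof -
    have "norm (backward_diff d k) = norm (\<Sum>j\<le>k. c j)"
      by (simp add: c_def sum_backward_diff)
    also have "\<dots> \<le> (\<Sum>j\<le>k. norm (c j))" by (rule norm_sum)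
    also have "\<dots> \<le> (\<Sum>j\<le>k. if j = 0 then 1 else 1 + q)"
      by (intro sum_mono) (use c0 c_bound in auto)
    also have "\<dots> = 1 + (1 + q) * real k"
      by (induction k) (auto simp: algebra_simps)
    finally show ?thesis .
  qed
  have d_bound: "norm (d k) \<le> real (k + 1) + (1 + q) * (real (k + 1) * real k / 2)" for k
  proof -
    have "norm (d k) = norm (\<Sum>j\<le>k. backward_diff d j)"
      by (simp add: sum_backward_diff)
    also have "\<dots> \<le> (\<Sum>j\<le>k. 1 + (1 + q) * real j)"
      by (intro sum_norm_le e_bound)
    also have "\<dots> = real (k + 1) + (1 + q) * (real (k + 1) * real k / 2)"
      by (induction k) (auto simp: field_simps)
    finally show ?thesis .
  qed
  show ?thesis
  proof (intro allI impI)
    fix n :: nat assume n: "n \<ge> 2"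
    have qn: "q ^ n < 1" using assms(1,2) n by (simp add: power_less_one_iff)
    have "d (n - 1) = a n * of_real ((1 - q ^ n) / (1 - q))"
      using n by (simp add: d_def)
    then have "norm (d (n - 1)) = norm (a n) * ((1 - q ^ n) / (1 - q))"
      using qn assms(2) by (simp only: norm_mult norm_of_real) simp
    then have "norm (a n) * ((1 - q ^ n) / (1 - q)) \<le>
        real n + (1 + q) * (real n * (real n - 1) / 2)"
      using d_bound[of "n - 1"] n by (simp add: of_nat_diff)
    then have "(1 - q) / (1 - q ^ n) * (norm (a n) * ((1 - q ^ n) / (1 - q))) \<le>
        (1 - q) / (1 - q ^ n) * (real n + (1 + q) * (real n * (real n - 1) / 2))"
      using qn assms(2) by (intro mult_left_mono) auto
    then show "cmod (a n) \<le> (1 - q) / (1 - q ^ n) * (real n + (1 + q) * (real n * (real n - 1) / 2))"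
      using qn assms(2) by simp
  qed
qed

end
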